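(* For every finite graph $G$, $\operatorname{bx}(G) \leq 6\operatorname{ltw}(G) + 4$.
   Context: A box in $\mathbb{R}^d$ is a Cartesian product of $d$ intervals of $\mathbb{R}$; the boxicity $\operatorname{bx}(G)$ is the minimum $d$ such that $G$ is the intersection graph of boxes in $\mathbb{R}^d$ (boxes $B_v$, $v\in V(G)$, with $B_v\cap B_w\ne\emptyset$ iff $vw\in E(G)$ for distinct $v,w$). A tree decomposition of $G$ is a family $(B_x : x\in V(T))$ of nonempty subsets of $V(G)$ indexed by the nodes of a tree $T$ such that for each $v\in V(G)$ the set $\{x: v\in B_x\}$ induces a nonempty connected subtree of $T$, and each edge $vw$ has both ends in some $B_x$. A layering of $G$ is a partition $(V_1,\dots,V_n)$ of $V(G)$ such that for every edge $vw$ there is $i\in[n-1]$ with $v,w\in V_i\cup V_{i+1}$. The layered treewidth $\operatorname{ltw}(G)$ is the minimum integer $k$ such that there exist a tree decomposition $(B_x:x\in V(T))$ and a layering $(V_1,\dots,V_n)$ of $G$ with $|B_x\cap V_i|\le k$ for every node $x$ and every $i$. *)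

theory Defs
  imports "HOL-Analysis.Analysis" "Graph_Theory.Graph_Theory"
begin

text \<open>
  A finite simple graph is a \<^locale>\<open>pair_graph\<close>: finite, loop-free, with a symmetric arc relation,
  so that the edge \<open>vw\<close> is the pair of arcs \<open>(v, w)\<close> and \<open>(w, v)\<close>.

  In a symmetric digraph the library's cycles include the closed walks \<open>u, v, u\<close>, hence the library's
  predicate \<^const>\<open>tree\<close> fails for every symmetric digraph with an arc. Excluding only the cycles of
  length at least three gives undirected trees.
\<close>

definition undirected_tree :: "'a pair_pre_digraph \<Rightarrow> bool" where
  "undirected_tree T \<longleftrightarrow>
     pair_graph T \<and> Digraph_Component.connected (with_proj T) \<and>
     \<not> (\<exists>p. pre_digraph.cycle (with_proj T) p \<and> 3 \<le> length p)"

text \<open>Points of d-dimensional real space are extensional functions on \<open>{..<d}\<close>.\<close>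

definition is_box :: "nat \<Rightarrow> (nat \<Rightarrow> real) set \<Rightarrow> bool" where
  "is_box d S \<longleftrightarrow>
     (\<exists>I. (\<forall>i<d. is_interval (I i) \<and> I i \<noteq> {}) \<and> S = (\<Pi>\<^sub>E i\<in>{..<d}. I i))"

definition box_representation ::
  "'a pair_pre_digraph \<Rightarrow> nat \<Rightarrow> ('a \<Rightarrow> (nat \<Rightarrow> real) set) \<Rightarrow> bool" where
  "box_representation G d S \<longleftrightarrow>
     (\<forall>v\<in>pverts G. is_box d (S v)) \<and>
     (\<forall>v\<in>pverts G. \<forall>w\<in>pverts G. v \<noteq> w \<longrightarrow>
        (S v \<inter> S w \<noteq> {} \<longleftrightarrow> (v, w) \<in> parcs G))"

text \<open>Minima are taken in \<^typ>\<open>enat\<close>; the minimum over the empty set is infinite.\<close>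

definition boxicity :: "'a pair_pre_digraph \<Rightarrow> enat" where
  "boxicity G = (INF d\<in>{d. \<exists>S. box_representation G d S}. enat d)"

text \<open>
  \<^const>\<open>Digraph_Component.connected\<close> includes having at least one vertex.
\<close>

definition tree_decomposition ::
  "'a pair_pre_digraph \<Rightarrow> 'b pair_pre_digraph \<Rightarrow> ('b \<Rightarrow> 'a set) \<Rightarrow> bool" where
  "tree_decomposition G T B \<longleftrightarrow>
     undirected_tree T \<and>
     (\<forall>x\<in>pverts T. B x \<noteq> {} \<and> B x \<subseteq> pverts G) \<and>
     (\<forall>v\<in>pverts G. Digraph_Component.connected (with_proj T \<restriction> {x\<in>pverts T. v \<in> B x})) \<and>
     (\<forall>(v, w)\<in>parcs G. \<exists>x\<in>pverts T. v \<in> B x \<and> w \<in> B x)"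

text \<open>Layers \<open>L 1, \<dots>, L n\<close>; some of them may be empty.\<close>

definition layering :: "'a pair_pre_digraph \<Rightarrow> nat \<Rightarrow> (nat \<Rightarrow> 'a set) \<Rightarrow> bool" where
  "layering G n L \<longleftrightarrow>
     (\<Union>i\<in>{1..n}. L i) = pverts G \<and> disjoint_family_on L {1..n} \<and>
     (\<forall>(v, w)\<in>parcs G. \<exists>i\<in>{1..n - 1}. v \<in> L i \<union> L (i + 1) \<and> w \<in> L i \<union> L (i + 1))"

text \<open>Trees are finite, so taking their nodes in \<^typ>\<open>nat\<close> loses nothing.\<close>

definition layered_width_at_most :: "'a pair_pre_digraph \<Rightarrow> nat \<Rightarrow> bool" where
  "layered_width_at_most G k \<longleftrightarrow>
     (\<exists>(T :: nat pair_pre_digraph) B n L.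
        tree_decomposition G T B \<and> layering G n L \<and>
        (\<forall>x\<in>pverts T. \<forall>i\<in>{1..n}. card (B x \<inter> L i) \<le> k))"

definition layered_treewidth :: "'a pair_pre_digraph \<Rightarrow> enat" where
  "layered_treewidth G = (INF k\<in>{k. layered_width_at_most G k}. enat k)"

end

theory Submission
  imports Defs
begin

text \<open>
  We obtain the stronger bound \<open>3k + 2\<close>, where \<open>k\<close> is the layered treewidth. Root the tree and number
  its nodes in depth-first order, so that the descendants of a node are numbered consecutively.
  Order the vertices by the topmost node \<open>top v\<close> of their subtrees: vertices sharing a bag are then
  comparable in the ancestor order, and the earlier one lies in the bag at the top of the later one.
  Hence each layer can be coloured greedily with \<open>k\<close> colours so that no bag repeats a colour
  within a layer. Adding the layer index modulo 3 yields \<open>3k\<close> colours for which any two vertices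
  that share a bag and have layers at distance at most 2 are coloured differently.

  One dimension separates vertices that are incomparable in the ancestor order, one separates vertices in
  layers at distance at least 2. In the dimension of colour \<open>c\<close>, a vertex of colour \<open>c\<close> is the
  point \<open>pre u\<close>, and any other vertex \<open>v\<close> is a half-line starting at its earliest neighbour of
  colour \<open>c\<close>, or at \<open>pre v\<close> if that is smaller. If \<open>v\<close> has a neighbour \<open>w\<close> of
  colour \<open>c\<close> that precedes it, a non-neighbour \<open>u\<close> of the same colour, in a layer next to that of
  \<open>v\<close>, cannot be an ancestor of \<open>v\<close> after \<open>w\<close>: the subtree of \<open>w\<close> contains the tree
  path from \<open>top w\<close> to \<open>top v\<close>, hence \<open>top u\<close>.
\<close>

section \<open>Connected sets of nodes in undirected trees\<close>

text \<open>\<open>rtrancl_on S\<close> keeps walks inside \<open>S\<close>, so for symmetric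
  \<open>E\<close> this is connectedness of the subgraph induced by \<open>S\<close>, without the
  symmetric closure taken in the library notion.\<close>

definition conn :: "'b rel \<Rightarrow> 'b set \<Rightarrow> bool" where
  "conn E S \<longleftrightarrow> S \<noteq> {} \<and> (\<forall>x\<in>S. \<forall>y\<in>S. (x, y) \<in> rtrancl_on S E)"

lemma rtrancl_on_Int_Times: "rtrancl_on S (E \<inter> S \<times> S) = rtrancl_on S E"
proof (intro set_eqI iffI; clarify)
  fix x y
  show "(x, y) \<in> rtrancl_on S E" if "(x, y) \<in> rtrancl_on S (E \<inter> S \<times> S)"
    using that by (induction rule: rtrancl_on_induct) (auto intro: rtrancl_on_into_rtrancl_on)
  show "(x, y) \<in> rtrancl_on S (E \<inter> S \<times> S)" if "(x, y) \<in> rtrancl_on S E"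
    using that by (induction rule: rtrancl_on_induct) (auto intro: rtrancl_on_into_rtrancl_on)
qed

lemma connected_induce_iff_conn:
  assumes "sym (parcs T)"
  shows "Digraph_Component.connected (with_proj T \<restriction> S) \<longleftrightarrow> conn (parcs T) S"
proof -
  have "parcs (mk_symmetric (with_proj T \<restriction> S)) = parcs T \<inter> S \<times> S"
    using assms by (auto simp: parcs_mk_symmetric induce_subgraph_def dest: symD)
  then show ?thesis
    by (simp add: connected_def strongly_connected_def conn_def reachable_def rtrancl_on_Int_Times)
qed

lemma undirected_tree_sym: "undirected_tree T \<Longrightarrow> sym (parcs T)"
  unfolding undirected_tree_def pair_graph_def pair_pseudo_graph_def pair_sym_digraph_def
    pair_sym_digraph_axioms_def symmetric_def by simp

lemma undirected_tree_conn:
  assumes "undirected_tree T"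
  shows "conn (parcs T) (pverts T)"
proof -
  interpret pair_graph T using assms by (simp add: undirected_tree_def)
  have "with_proj T \<restriction> pverts T = with_proj T"
    by (auto simp: induce_subgraph_def with_proj_def arc_fst_in_verts arc_snd_in_verts
        intro: in_arcsD1 in_arcsD2)
  then show ?thesis
    using connected_induce_iff_conn[OF undirected_tree_sym[OF assms], of "pverts T"] assms
    by (simp add: undirected_tree_def)
qed

lemma pawalk_verts_snoc: "pcas u w v \<Longrightarrow> pawalk_verts u (w @ [(v, x)]) = pawalk_verts u w @ [x]"
  by (induction u w v rule: pcas.induct) auto

lemma pcas_snoc: "pcas u w v \<Longrightarrow> pcas u (w @ [(v, x)]) x"
  by (induction u w v rule: pcas.induct) auto

text \<open>Otherwise a simple path from \<open>p\<close> to \<open>q\<close> inside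
  \<open>S\<close> closes up through \<open>l\<close> to a cycle.\<close>

lemma undirected_tree_unique_neighbour:
  assumes T: "undirected_tree T" and S: "conn (parcs T) S" "S \<subseteq> pverts T"
    and l: "l \<notin> S" and p: "p \<in> S" "(p, l) \<in> parcs T" and q: "q \<in> S" "(q, l) \<in> parcs T"
  shows "p = q"
proof (rule ccontr)
  assume "p \<noteq> q"
  interpret T: pair_graph T using T by (simp add: undirected_tree_def)
  define H where "H = \<lparr>pverts = S, parcs = parcs T \<inter> S \<times> S\<rparr>"
  interpret H: pair_wf_digraph H by unfold_locales (auto simp: H_def)
  have "(p, q) \<in> rtrancl_on S (parcs T)" using S p q by (auto simp: conn_def)
  then have "p \<rightarrow>\<^sup>*\<^bsub>with_proj H\<^esub> q"
    by (simp add: reachable_def H_def rtrancl_on_Int_Times)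
  then obtain w where w: "H.apath p w q" by (auto simp: H.reachable_apath)
  then have walk: "set w \<subseteq> parcs T" "pcas p w q" "distinct (pawalk_verts p w)"
    "set (pawalk_verts p w) \<subseteq> S"
    using H.awalk_verts_in_verts[of p w] unfolding H.apath_def H.awalk_def by (auto simp: H_def)
  \<comment> \<open>Rules out the closed walk \<open>l, p, l\<close>: the cycle has at least three
    arcs.\<close>
  have "w \<noteq> []" using walk \<open>p \<noteq> q\<close> by auto
  let ?c = "(l, p) # w @ [(q, l)]"
  have lp: "(l, p) \<in> parcs T" using p undirected_tree_sym[OF T] by (auto dest: symD)
  have "pcas l ?c l"
    using pcas_snoc[OF walk(2), of l] by (simp only: pcas.simps fst_conv snd_conv simp_thms)
  then have "T.awalk l ?c l"
    unfolding T.awalk_def using walk lp q T.arc_fst_in_verts[OF lp] by (simp del: pcas.simps T.cas_append_iff)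
  moreover have "distinct (tl (pawalk_verts l ?c))"
    using walk l by (auto simp: pawalk_verts_snoc)
  ultimately have "T.cycle ?c" by (auto simp: T.cycle_def)
  moreover have "3 \<le> length ?c" using \<open>w \<noteq> []\<close> by (cases w) auto
  ultimately show False using T unfolding undirected_tree_def by blast
qed

section \<open>Depth-first numbering of a tree\<close>

text \<open>
  \<open>pre\<close> is a preorder numbering and \<open>post x\<close> bounds the numbers in the subtree below \<open>x\<close>, so
  \<open>z\<close> is an ancestor of \<open>x\<close> iff \<open>pre z \<le> pre x \<le> post z\<close>. Only the consequences
  for connected sets of nodes are recorded: they lie below their first node \<open>t\<close> and are closed under
  passing to ancestors below \<open>t\<close>.
\<close>

definition tree_numbering :: "'b rel \<Rightarrow> 'b set \<Rightarrow> ('b \<Rightarrow> nat) \<Rightarrow> ('b \<Rightarrow> nat) \<Rightarrow> bool" where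
  "tree_numbering E V pre post \<longleftrightarrow>
     (\<forall>S t x. S \<subseteq> V \<and> conn E S \<and> t \<in> S \<and> x \<in> S \<and> (\<forall>y\<in>S. pre t \<le> pre y) \<longrightarrow>
        pre x \<le> post t \<and>
        (\<forall>z\<in>V. pre t \<le> pre z \<and> pre z \<le> pre x \<and> pre x \<le> post z \<longrightarrow> z \<in> S))"

lemma tree_numbering_le_post:
  assumes "tree_numbering E V pre post" "S \<subseteq> V" "conn E S" "t \<in> S" "x \<in> S"
    and "\<And>y. y \<in> S \<Longrightarrow> pre t \<le> pre y"
  shows "pre x \<le> post t"
  using assms unfolding tree_numbering_def by blast

lemma tree_numbering_between:
  assumes "tree_numbering E V pre post" "S \<subseteq> V" "conn E S" "t \<in> S" "x \<in> S"
    and "\<And>y. y \<in> S \<Longrightarrow> pre t \<le> pre y"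
    and "z \<in> V" "pre t \<le> pre z" "pre z \<le> pre x" "pre x \<le> post z"
  shows "z \<in> S"
  using assms unfolding tree_numbering_def by blast

text \<open>Any visit of a walk to \<open>l\<close> comes from \<open>p\<close> and returns to
  \<open>p\<close>, so it can be cut out.\<close>

lemma conn_remove_leaf:
  assumes S: "conn E S" "S \<noteq> {l}" and l: "l \<in> S"
    and nb: "\<And>x. x \<in> S \<Longrightarrow> x \<noteq> l \<Longrightarrow> (x, l) \<in> E \<or> (l, x) \<in> E \<Longrightarrow> x = p"
  shows "p \<in> S" "p \<noteq> l" "conn E (S - {l})"
proof -
  obtain y where y: "y \<in> S" "y \<noteq> l" using S l by (auto simp: conn_def)
  \<comment> \<open>While the walk stands at \<open>l\<close>, the invariant records that
    \<open>p\<close> has been reached.\<close>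
  have walk: "(z = l \<longrightarrow> (x, p) \<in> rtrancl_on (S - {l}) E) \<and>
      (z \<noteq> l \<longrightarrow> (x, z) \<in> rtrancl_on (S - {l}) E)"
    if "(x, z) \<in> rtrancl_on S E" "x \<noteq> l" for x z
    using that
  proof (induction rule: rtrancl_on_induct)
    case base
    then show ?case by auto
  next
    case (step a b)
    show ?case
    proof (cases "b = l")
      case True
      show ?thesis
      proof (cases "a = l")
        case False
        then have "a = p" using nb step True by auto
        then show ?thesis using False True step by auto
      qed (use step True in auto)
    next
      case False
      show ?thesis
      proof (cases "a = l")
        case True
        then have "b = p" using nb step False by auto
        then show ?thesis using False True step by auto
      next
        case False
        then show ?thesis using \<open>b \<noteq> l\<close> step by (auto intro: rtrancl_on_into_rtrancl_on)
      qed
    qed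
  qed
  have "(y, l) \<in> rtrancl_on S E" using y l S by (auto simp: conn_def)
  then have "(y, p) \<in> rtrancl_on (S - {l}) E" using walk y by blast
  then have "p \<in> S - {l}" by (rule in_rtrancl_on_in_F)
  then show "p \<in> S" "p \<noteq> l" by auto
  show "conn E (S - {l})" using S y walk by (auto simp: conn_def)
qed

text \<open>Doubling all numbers makes room for the new leaf directly after its neighbour.\<close>

lemma tree_numbering_add_leaf:
  assumes num: "tree_numbering E V pre post" and l: "l \<notin> V" and p: "p \<in> V"
    and nb: "\<And>x. x \<in> V \<Longrightarrow> (x, l) \<in> E \<or> (l, x) \<in> E \<Longrightarrow> x = p"
  shows "tree_numbering E (insert l V)
           (\<lambda>x. if x = l then 2 * pre p + 1 else 2 * pre x)
           (\<lambda>x. if x = l then 2 * pre p + 1 else 2 * post x + 1)"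
    (is "tree_numbering E _ ?pre ?post")
proof -
  note sub = tree_numbering_le_post[OF num] and sub' = tree_numbering_between[OF num]
  have odd: "2 * a \<noteq> Suc (2 * b)" for a b :: nat by presburger
  have "?pre x \<le> ?post t \<and> (\<forall>z\<in>insert l V. ?pre t \<le> ?pre z \<and> ?pre z \<le> ?pre x \<and> ?pre x \<le> ?post z \<longrightarrow> z \<in> S)"
    if S: "S \<subseteq> insert l V" "conn E S" and t: "t \<in> S" and x: "x \<in> S"
      and min: "\<forall>y\<in>S. ?pre t \<le> ?pre y" for S t x
  proof (cases "l \<in> S")
    case False
    then have S': "S \<subseteq> V" "t \<noteq> l" "x \<noteq> l" using S t x by auto
    have min': "pre t \<le> pre y" if "y \<in> S" for y
      using min S' False that by (auto split: if_splits)
    have "pre x \<le> post t" by (rule sub[OF S'(1) S(2) t x min'])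
    moreover have "z \<in> S"
      if z: "z \<in> insert l V" "?pre t \<le> ?pre z" "?pre z \<le> ?pre x" "?pre x \<le> ?post z" for z
    proof -
      \<comment> \<open>The number and the bound of \<open>l\<close> are the same odd value, whereas
        \<open>?pre x\<close> is even here.\<close>
      have "z \<noteq> l" using z S' odd by (auto simp: le_antisym)
      then show ?thesis using z S' by (intro sub'[OF S'(1) S(2) t x min', of z]) auto
    qed
    ultimately show ?thesis using S' by auto
  next
    case True
    show ?thesis
    proof (cases "S = {l}")
      case True
      then have "t = l" "x = l" using t x by auto
      then show ?thesis
        using True odd by (auto split: if_splits) (metis le_antisym odd)+
    next
      case False
      have "x = p" if "x \<in> S" "x \<noteq> l" "(x, l) \<in> E \<or> (l, x) \<in> E" for x
        using nb that S by auto
      note leaf = conn_remove_leaf[OF S(2) False \<open>l \<in> S\<close> this]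
      let ?R = "S - {l}"
      have R: "?R \<subseteq> V" "p \<in> ?R" using S leaf by auto
      \<comment> \<open>The number of \<open>p\<close> is one below that of \<open>l\<close>, so
        \<open>l\<close> is not the first node of \<open>S\<close>.\<close>
      have "t \<noteq> l" using min leaf by force
      then have tR: "t \<in> ?R" using t by auto
      have min': "pre t \<le> pre y" if "y \<in> ?R" for y
        using min \<open>t \<noteq> l\<close> that by (auto split: if_splits)
      \<comment> \<open>The ancestors of \<open>l\<close> other than \<open>l\<close> are those of
        \<open>p\<close>, so \<open>p\<close> can stand in for \<open>l\<close>.\<close>
      define x' where "x' = (if x = l then p else x)"
      have x'R: "x' \<in> ?R" using x R by (auto simp: x'_def)
      have "pre x' \<le> post t" by (rule sub[OF R(1) leaf(3) tR x'R min'])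
      moreover have "z \<in> S"
        if z: "z \<in> insert l V" "?pre t \<le> ?pre z" "?pre z \<le> ?pre x" "?pre x \<le> ?post z" for z
      proof (cases "z = l")
        case False
        then have "z \<in> ?R" using z \<open>t \<noteq> l\<close>
          by (intro sub'[OF R(1) leaf(3) tR x'R min', of z]) (auto simp: x'_def split: if_splits)
        then show ?thesis by simp
      qed (use \<open>l \<in> S\<close> in simp)
      ultimately show ?thesis using \<open>t \<noteq> l\<close> by (auto simp: x'_def)
    qed
  qed
  then show ?thesis unfolding tree_numbering_def by (intro allI impI) (elim conjE)
qed

lemma conn_insert:
  assumes S: "conn E S" and p: "p \<in> S" "(p, l) \<in> E" "(l, p) \<in> E"
  shows "conn E (insert l S)"
proof -
  have mono: "(x, y) \<in> rtrancl_on (insert l S) E" if "(x, y) \<in> rtrancl_on S E" for x y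
    using that by (induction rule: rtrancl_on_induct) (auto intro: rtrancl_on_into_rtrancl_on)
  have "(x, p) \<in> rtrancl_on (insert l S) E \<and> (p, x) \<in> rtrancl_on (insert l S) E"
    if "x \<in> insert l S" for x
  proof (cases "x = l")
    case True
    then show ?thesis using p
      by (auto intro: rtrancl_on_into_rtrancl_on rtrancl_on_refl)
  next
    case False
    then show ?thesis using S p that mono by (auto simp: conn_def)
  qed
  then show ?thesis unfolding conn_def by (blast intro: rtrancl_on_trans)
qed

text \<open>A maximal numbered subtree is the whole tree: an arc leaving it would end in a node with
  a unique neighbour inside, which could be added as a leaf.\<close>

lemma undirected_tree_numbering:
  assumes T: "undirected_tree T"
  obtains pre post where "tree_numbering (parcs T) (pverts T) pre post"
proof -
  let ?E = "parcs T" and ?V = "pverts T"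
  interpret T: pair_graph T using T by (simp add: undirected_tree_def)
  define P where "P S \<longleftrightarrow> S \<subseteq> ?V \<and> conn ?E S \<and> (\<exists>pre post. tree_numbering ?E S pre post)" for S
  have conn: "conn ?E ?V" by (rule undirected_tree_conn[OF T])
  then obtain r where r: "r \<in> ?V" by (auto simp: conn_def)
  have "tree_numbering ?E {r} (\<lambda>_. 0) (\<lambda>_. 0)" by (auto simp: tree_numbering_def)
  then have "P {r}" using r by (auto simp: P_def conn_def)
  moreover have "finite {S. P S}"
    by (rule finite_subset[of _ "Pow ?V"]) (auto simp: P_def T.pair_finite_verts)
  ultimately have "\<exists>S\<in>{S. P S}. \<forall>S'\<in>{S. P S}. S \<subseteq> S' \<longrightarrow> S = S'"
    by (intro finite_has_maximal) auto
  then obtain S where PS: "P S" and max: "\<And>S'. P S' \<Longrightarrow> S \<subseteq> S' \<Longrightarrow> S = S'"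
    by blast
  then have S: "S \<subseteq> ?V" "conn ?E S" and num: "\<exists>pre post. tree_numbering ?E S pre post"
    by (simp_all add: P_def)
  have "S = ?V"
  proof (rule ccontr)
    assume "S \<noteq> ?V"
    then obtain v where v: "v \<in> ?V" "v \<notin> S" using S by auto
    obtain s where s: "s \<in> S" using S by (auto simp: conn_def)
    have "(s, v) \<in> rtrancl_on ?V ?E" using conn s v S by (auto simp: conn_def)
    then have "v \<notin> S \<longrightarrow> (\<exists>p l. p \<in> S \<and> l \<notin> S \<and> (p, l) \<in> ?E)"
      by (induction rule: rtrancl_on_induct) (use s in auto)
    then obtain p l where pl: "p \<in> S" "l \<notin> S" "(p, l) \<in> ?E" using v by auto
    have lp: "(l, p) \<in> ?E" using pl undirected_tree_sym[OF T] by (auto dest: symD)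
    have lV: "l \<in> ?V" using T.in_arcsD2[OF pl(3)] by simp
    have "x = p" if "x \<in> S" "(x, l) \<in> ?E \<or> (l, x) \<in> ?E" for x
      using undirected_tree_unique_neighbour[OF T, of S l x p] S pl that undirected_tree_sym[OF T]
      by (auto dest: symD)
    then have "\<exists>pre post. tree_numbering ?E (insert l S) pre post"
      using num tree_numbering_add_leaf[of ?E S _ _ l p] pl by blast
    then have "P (insert l S)" unfolding P_def using conn_insert[OF S(2) pl(1,3) lp] S lV by simp
    then show False using max[of "insert l S"] pl by auto
  qed
  then show thesis using num that by auto
qed

section \<open>Ordering the vertices by the tops of their subtrees\<close>

text \<open>If the subtrees of \<open>u\<close> and \<open>v\<close> share \<open>x\<close>, both
  tops are ancestors of \<open>x\<close>. The subtree of the earlier vertex contains the path from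
  its top to \<open>x\<close>, and this path passes the other top.\<close>

lemma tree_decomposition_vertex_order:
  fixes G :: "'a pair_pre_digraph" and T :: "'b pair_pre_digraph"
  assumes G: "pair_graph G" and TD: "tree_decomposition G T B"
  obtains pre post :: "'a \<Rightarrow> nat" and top :: "'a \<Rightarrow> 'b"
  where "inj_on pre (pverts G)"
    and "\<And>v. v \<in> pverts G \<Longrightarrow> pre v \<le> post v \<and> top v \<in> pverts T \<and> v \<in> B (top v)"
    and "\<And>u v x. \<lbrakk>x \<in> pverts T; u \<in> B x; v \<in> B x; pre u \<le> pre v\<rbrakk>
           \<Longrightarrow> pre v \<le> post u \<and> u \<in> B (top v)"
    and "\<And>u v w. \<lbrakk>u \<in> pverts G; v \<in> pverts G; w \<in> pverts G; u \<in> B (top w);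
           pre u \<le> pre v; pre v \<le> pre w; pre w \<le> post v\<rbrakk> \<Longrightarrow> u \<in> B (top v)"
proof -
  let ?V = "pverts G"
  let ?S = "\<lambda>v. {x \<in> pverts T. v \<in> B x}"
  interpret G: pair_graph G by fact
  have T: "undirected_tree T" using TD by (simp add: tree_decomposition_def)
  obtain npre npost where num: "tree_numbering (parcs T) (pverts T) npre npost"
    by (rule undirected_tree_numbering[OF T])
  have bag: "v \<in> ?V" if "x \<in> pverts T" "v \<in> B x" for x v
    using TD that by (auto simp: tree_decomposition_def)
  have conn: "conn (parcs T) (?S v)" if "v \<in> ?V" for v
    using TD that connected_induce_iff_conn[OF undirected_tree_sym[OF T]]
    by (simp add: tree_decomposition_def)
  define top where "top v = arg_min_on npre (?S v)" for v
  have top: "top v \<in> ?S v" "\<And>x. x \<in> ?S v \<Longrightarrow> npre (top v) \<le> npre x" if "v \<in> ?V" for v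
  proof -
    have "finite (pverts T)"
      using T by (simp add: undirected_tree_def pair_graph_def pair_digraph_def pair_fin_digraph_def
          pair_fin_digraph_axioms_def)
    then have fin: "finite (?S v)" by simp
    moreover have ne: "?S v \<noteq> {}" using conn[OF that] by (simp add: conn_def)
    ultimately show "top v \<in> ?S v" unfolding top_def by (rule arg_min_if_finite)
    show "npre (top v) \<le> npre x" if "x \<in> ?S v" for x
      unfolding top_def by (rule arg_min_least[OF fin ne that])
  qed
  have top_post: "npre x \<le> npost (top v)" if "v \<in> ?V" "x \<in> ?S v" for v x
    using tree_numbering_le_post[OF num _ conn[OF that(1)] top(1)[OF that(1)] that(2) top(2)[OF that(1)]]
    by auto
  have between: "v \<in> B z" if "v \<in> ?V" "x \<in> ?S v" "z \<in> pverts T"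
    "npre (top v) \<le> npre z" "npre z \<le> npre x" "npre x \<le> npost z" for v x z
    using tree_numbering_between[OF num _ conn[OF that(1)] top(1)[OF that(1)] that(2) top(2)[OF that(1)]
        that(3-6)] by auto
  obtain idx :: "'a \<Rightarrow> nat" and N where idx: "idx ` ?V = {i. i < N}" "inj_on idx ?V"
    using finite_imp_inj_to_nat_seg[OF G.pair_finite_verts] by blast
  have idx_less: "idx v < N" if "v \<in> ?V" for v using idx that by auto
  \<comment> \<open>Vertices with the same top node are ordered by \<open>idx\<close>.\<close>
  define pre where "pre v = N * npre (top v) + idx v" for v
  \<comment> \<open>The last number in the block of \<open>N\<close> numbers reserved for
    \<open>npost (top v)\<close>.\<close>
  define post where "post v = N * npost (top v) + (N - 1)" for v
  have block: "a \<le> b" if "N * a + i \<le> N * b + j" "j < N" for a b i j :: nat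
  proof (rule ccontr)
    assume "\<not> a \<le> b"
    then have "N * (b + 1) \<le> N * a" by (intro mult_le_mono2) simp
    then show False using that by (simp add: algebra_simps)
  qed
  have pre_le: "npre (top u) \<le> npre (top v)" if "v \<in> ?V" "pre u \<le> pre v" for u v
    using block[of _ "idx u" _ "idx v"] that idx_less[OF that(1)] unfolding pre_def by blast
  have pre_post: "pre v \<le> post u" if "v \<in> ?V" "npre (top v) \<le> npost (top u)" for u v
    using mult_le_mono2[OF that(2), of N] idx_less[OF that(1)]
    unfolding pre_def post_def by linarith
  have post_le: "npre (top v) \<le> npost (top u)" if "u \<in> ?V" "pre v \<le> post u" for u v
  proof (rule block)
    show "N * npre (top v) + idx v \<le> N * npost (top u) + (N - 1)"
      using that(2) by (simp only: pre_def post_def)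
    show "N - 1 < N" using idx_less[OF that(1)] by simp
  qed
  show thesis
  proof (rule that[of pre post top])
    show "inj_on pre ?V"
    proof (rule inj_onI)
      fix u v assume uv: "u \<in> ?V" "v \<in> ?V" "pre u = pre v"
      then have "npre (top u) = npre (top v)" by (intro le_antisym pre_le) auto
      then have "idx u = idx v" using uv by (simp add: pre_def)
      then show "u = v" using idx uv by (auto dest: inj_onD)
    qed
    show "pre v \<le> post v \<and> top v \<in> pverts T \<and> v \<in> B (top v)" if "v \<in> ?V" for v
      using top[OF that] top_post[OF that top(1)[OF that]] pre_post[OF that, of v] by simp
    show "pre v \<le> post u \<and> u \<in> B (top v)"
      if x: "x \<in> pverts T" "u \<in> B x" "v \<in> B x" and le: "pre u \<le> pre v" for u v x
    proof -
      have V: "u \<in> ?V" "v \<in> ?V" using bag x by auto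
      have uB: "u \<in> B (top v)"
        using x V top[OF V(2)] pre_le[OF V(2) le] top_post[OF V(2)] by (intro between[of u x]) auto
      moreover have "npre (top v) \<le> npost (top u)"
        using top_post[OF V(1)] top(1)[OF V(2)] uB by simp
      ultimately show ?thesis using pre_post[OF V(2)] by simp
    qed
    show "u \<in> B (top v)"
      if V: "u \<in> ?V" "v \<in> ?V" "w \<in> ?V" and u: "u \<in> B (top w)"
        and le: "pre u \<le> pre v" "pre v \<le> pre w" "pre w \<le> post v" for u v w
      using V u top(1)[OF V(2)] top(1)[OF V(3)] pre_le[OF V(2) le(1)] pre_le[OF V(3) le(2)]
        post_le[OF V(2) le(3)]
      by (intro between[of u "top w"]) auto
  qed
qed

section \<open>Greedy colouring along the order\<close>

lemma greedy_colouring: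
  fixes pre :: "'a \<Rightarrow> nat" and A :: "'a \<Rightarrow> 'a set"
  assumes inj: "inj_on pre V"
    and A: "\<And>v. v \<in> V \<Longrightarrow> finite (A v) \<and> card (A v) < k"
  obtains col :: "'a \<Rightarrow> nat"
  where "\<And>v. v \<in> V \<Longrightarrow> col v < k"
    and "\<And>u v. u \<in> V \<Longrightarrow> v \<in> V \<Longrightarrow> pre u < pre v \<Longrightarrow> u \<in> A v \<Longrightarrow> col u \<noteq> col v"
proof -
  define step where "step f v = (SOME c. c < k \<and> c \<notin> f ` A v)" for f :: "'a \<Rightarrow> nat" and v
  have step: "step f v < k \<and> step f v \<notin> f ` A v" if "v \<in> V" for f v
  proof -
    have "card (f ` A v) < card {..<k}" using A[OF that] card_image_le[of "A v" f] by auto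
    then have "\<not> {..<k} \<subseteq> f ` A v" using card_mono[of "f ` A v" "{..<k}"] A[OF that] by auto
    then have "\<exists>c. c < k \<and> c \<notin> f ` A v" by auto
    then show ?thesis unfolding step_def by (rule someI_ex)
  qed
  define col where "col = wfrec (Wellfounded.measure pre) step"
  \<comment> \<open>At members of \<open>A v\<close> that do not precede \<open>v\<close>,
    \<open>cut\<close> yields \<open>undefined\<close>. This is harmless: the image of
    \<open>A v\<close> still has fewer than \<open>k\<close> elements, so a colour is free.\<close>
  have adm: "col v = step (cut col (Wellfounded.measure pre) v) v" for v
    unfolding col_def by (rule wfrec) simp
  have "col v < k" if "v \<in> V" for v
    using step[OF that] adm[of v] by metis
  moreover have "col u \<noteq> col v" if "u \<in> V" "v \<in> V" "pre u < pre v" "u \<in> A v" for u v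
  proof -
    have "cut col (Wellfounded.measure pre) v u = col u" using that by (simp add: cut_apply)
    then show ?thesis using step[OF that(2), of "cut col (Wellfounded.measure pre) v"] adm[of v] that(4) by force
  qed
  ultimately show thesis by (rule that)
qed

section \<open>From a layered tree decomposition to boxes\<close>

lemma layered_width_imp_box_representation:
  fixes G :: "'a pair_pre_digraph"
  assumes G: "pair_graph G" and "layered_width_at_most G k"
  shows "\<exists>S. box_representation G (3 * k + 2) S"
proof -
  let ?V = "pverts G" and ?E = "parcs G"
  interpret G: pair_graph G by fact
  obtain T :: "nat pair_pre_digraph" and B n L where TD: "tree_decomposition G T B"
    and L: "layering G n L" and width: "\<And>x i. x \<in> pverts T \<Longrightarrow> i \<in> {1..n} \<Longrightarrow> card (B x \<inter> L i) \<le> k"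
    using assms(2) unfolding layered_width_at_most_def by blast
  obtain pre post :: "'a \<Rightarrow> nat" and top where inj: "inj_on pre ?V"
    and top: "\<And>v. v \<in> ?V \<Longrightarrow> pre v \<le> post v \<and> top v \<in> pverts T \<and> v \<in> B (top v)"
    and share: "\<And>u v x. \<lbrakk>x \<in> pverts T; u \<in> B x; v \<in> B x; pre u \<le> pre v\<rbrakk>
           \<Longrightarrow> pre v \<le> post u \<and> u \<in> B (top v)"
    and between: "\<And>u v w. \<lbrakk>u \<in> ?V; v \<in> ?V; w \<in> ?V; u \<in> B (top w);
           pre u \<le> pre v; pre v \<le> pre w; pre w \<le> post v\<rbrakk> \<Longrightarrow> u \<in> B (top v)"
    by (rule tree_decomposition_vertex_order[OF G TD]) (rule that; assumption | blast)
  have bag_sub: "B x \<subseteq> ?V" if "x \<in> pverts T" for x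
    using TD that by (auto simp: tree_decomposition_def)
  have sym: "(v, u) \<in> ?E" if "(u, v) \<in> ?E" for u v
    using that G.pair_sym_arcs by (auto simp: symmetric_def dest: symD)
  have edge_V: "u \<in> ?V" "v \<in> ?V" "u \<noteq> v" if "(u, v) \<in> ?E" for u v
    using G.arc_fst_in_verts[OF that] G.arc_snd_in_verts[OF that] G.pair_no_loops[OF that] by simp_all
  have edge_bag: "\<exists>x\<in>pverts T. u \<in> B x \<and> v \<in> B x" if "(u, v) \<in> ?E" for u v
  proof -
    have "\<forall>(v, w)\<in>?E. \<exists>x\<in>pverts T. v \<in> B x \<and> w \<in> B x"
      using TD unfolding tree_decomposition_def by (elim conjE)
    then show ?thesis using that by (auto dest: bspec)
  qed

  have "\<forall>v\<in>?V. \<exists>i\<in>{1..n}. v \<in> L i" using L by (auto simp: layering_def)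
  then obtain lay where lay: "\<And>v. v \<in> ?V \<Longrightarrow> lay v \<in> {1..n} \<and> v \<in> L (lay v)"
    unfolding bchoice_iff Bex_def by blast
  have lay_eq: "lay v = i" if "v \<in> ?V" "i \<in> {1..n}" "v \<in> L i" for v i
  proof -
    have "disjoint_family_on L {1..n}" using L by (simp add: layering_def)
    then show ?thesis using lay[OF that(1)] that(2,3) unfolding disjoint_family_on_def by blast
  qed
  have edge_lay: "lay u \<le> lay v + 1" if e: "(u, v) \<in> ?E" for u v
  proof -
    have "\<forall>(v, w)\<in>?E. \<exists>i\<in>{1..n - 1}. v \<in> L i \<union> L (i + 1) \<and> w \<in> L i \<union> L (i + 1)"
      using L unfolding layering_def by (elim conjE)
    then obtain i where i: "i \<in> {1..n - 1}" "u \<in> L i \<union> L (i + 1)" "v \<in> L i \<union> L (i + 1)"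
      using e by (auto dest!: bspec)
    then have "lay u \<in> {i, i + 1}" "lay v \<in> {i, i + 1}"
      using lay_eq edge_V[OF e] by force+
    then show ?thesis by auto
  qed

  \<comment> \<open>By \<open>share\<close>, this contains every earlier vertex in the layer of
    \<open>v\<close> that meets \<open>v\<close> in some bag. Leaving out \<open>v\<close> gives the
    strict bound \<open>k\<close>.\<close>
  define A where "A v = B (top v) \<inter> L (lay v) - {v}" for v
  have "finite (A v) \<and> card (A v) < k" if v: "v \<in> ?V" for v
  proof -
    have fin: "finite (B (top v) \<inter> L (lay v))"
      using top[OF v] bag_sub G.pair_finite_verts by (meson finite_Int finite_subset)
    moreover have "v \<in> B (top v) \<inter> L (lay v)" using top[OF v] lay[OF v] by simp
    ultimately have "card (A v) < card (B (top v) \<inter> L (lay v))"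
      unfolding A_def by (rule card_Diff1_less)
    also have "\<dots> \<le> k" using width top[OF v] lay[OF v] by blast
    finally show ?thesis using fin by (simp add: A_def)
  qed
  then obtain col where col: "\<And>v. v \<in> ?V \<Longrightarrow> col v < k"
    and col_A: "\<And>u v. u \<in> ?V \<Longrightarrow> v \<in> ?V \<Longrightarrow> pre u < pre v \<Longrightarrow> u \<in> A v \<Longrightarrow> col u \<noteq> col v"
    using greedy_colouring[OF inj] by blast
  define C where "C v = 3 * col v + lay v mod 3" for v
  have C_less: "C v < 3 * k" if "v \<in> ?V" for v using col[OF that] by (simp add: C_def)
  have "C v div 3 = col v" "C v mod 3 = lay v mod 3" for v by (simp_all add: C_def)
  then have C_eqD: "col u = col v" "lay u mod 3 = lay v mod 3" if "C u = C v" for u v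
    using that by metis+
  have C_eq: "u = v" if x: "x \<in> pverts T" "u \<in> B x" "v \<in> B x" and C: "C u = C v"
    and le: "lay u \<le> lay v + 2" "lay v \<le> lay u + 2" for u v x
  proof -
    have l: "lay u = lay v" using C_eqD(2)[OF C] le by presburger
    have *: "\<not> pre u < pre v" if "u \<in> B x" "v \<in> B x" "lay u = lay v" "col u = col v" for u v
    proof
      assume lt: "pre u < pre v"
      have V: "u \<in> ?V" "v \<in> ?V" using bag_sub x that by auto
      have "u \<in> A v" unfolding A_def using share[OF x(1) that(1,2)] lt lay[OF V(1)] that(3) by auto
      then show False using col_A[OF V lt] that by simp
    qed
    then have "pre u = pre v" using x l C_eqD(1)[OF C] by (metis nat_neq_iff)
    then show ?thesis using inj bag_sub x by (auto dest: inj_onD)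
  qed

  \<comment> \<open>Inserting \<open>v\<close> supplies the default \<open>pre v\<close> when no
    earlier neighbour has colour \<open>c\<close>.\<close>
  define start where "start v c = Min (pre ` insert v {u. (u, v) \<in> ?E \<and> C u = c \<and> pre u \<le> pre v})" for v c
  have fin: "finite {u. (u, v) \<in> ?E \<and> C u = c \<and> pre u \<le> pre v}" for v c
    using edge_V(1) by (intro finite_subset[OF _ G.pair_finite_verts]) auto
  have start_le: "start v c \<le> pre v" for v c
    unfolding start_def using fin by (intro Min_le) auto
  have start_edge: "start v c \<le> pre u" if "(u, v) \<in> ?E" "C u = c" for u v c
  proof (cases "pre u \<le> pre v")
    case True
    then show ?thesis unfolding start_def using fin that by (intro Min_le) auto
  qed (use start_le[of v c] in simp)
  have start_sep: "pre u < start v (C u)"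
    if V: "u \<in> ?V" "v \<in> ?V" "u \<noteq> v" and nadj: "(u, v) \<notin> ?E" and anc: "pre u \<le> pre v" "pre v \<le> post u"
      and l: "lay u \<le> lay v + 1" "lay v \<le> lay u + 1" for u v
  proof (rule ccontr)
    assume neg: "\<not> pre u < start v (C u)"
    have "start v (C u) \<in> pre ` insert v {w. (w, v) \<in> ?E \<and> C w = C u \<and> pre w \<le> pre v}"
      unfolding start_def using fin by (intro Min_in) auto
    \<comment> \<open>The minimum is not attained at \<open>v\<close>, as this would force
      \<open>pre v = pre u\<close>; so it comes from a neighbour \<open>w\<close>.\<close>
    moreover have "pre u \<noteq> pre v" using inj V by (auto dest: inj_onD)
    ultimately obtain w where w: "(w, v) \<in> ?E" "C w = C u" "pre w \<le> pre v" "pre w \<le> pre u"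
      using neg anc by fastforce
    obtain x where "x \<in> pverts T" "w \<in> B x" "v \<in> B x" using edge_bag[OF w(1)] by auto
    then have "w \<in> B (top v)" using share w(3) by blast
    then have "w \<in> B (top u)" using between[of w u v] V edge_V[OF w(1)] w anc by blast
    \<comment> \<open>Both \<open>u\<close> and \<open>w\<close> are within one layer of
      \<open>v\<close>, hence within two of each other; this is why layers are taken modulo
      3.\<close>
    moreover have "lay w \<le> lay v + 1" "lay v \<le> lay w + 1"
      using edge_lay w(1) sym by auto
    ultimately have "w = u" using C_eq[of "top u" w u] top[OF V(1)] w l by auto
    then show False using w nadj by simp
  qed

  \<comment> \<open>Unit intervals at integers meet iff the layers differ by at most 1. Colour
    \<open>c\<close> owns coordinate \<open>c + 2\<close>.\<close>
  define I :: "'a \<Rightarrow> nat \<Rightarrow> real set" where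
    "I v i = (if i = 0 then {real (pre v)..real (post v)}
              else if i = 1 then {real (lay v)..real (lay v) + 1}
              else if C v = i - 2 then {real (pre v)} else {real (start v (i - 2))..})" for v i
  have box: "is_box (3 * k + 2) (\<Pi>\<^sub>E i\<in>{..<3 * k + 2}. I v i)" if "v \<in> ?V" for v
    unfolding is_box_def using top[OF that]
    by (intro exI[of _ "I v"]) (auto simp: I_def is_interval_1 is_interval_cc is_interval_ci)
  have meet: "I u i \<inter> I v i \<noteq> {}" if e: "(u, v) \<in> ?E" and le: "pre u \<le> pre v" for u v i
  proof -
    obtain x where x: "x \<in> pverts T" "u \<in> B x" "v \<in> B x" using edge_bag[OF e] by auto
    have post: "pre v \<le> post u" using share[OF x le] by simp
    have l: "lay u \<le> lay v + 1" "lay v \<le> lay u + 1" using edge_lay e sym by auto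
    have "C u \<noteq> C v" using C_eq[OF x] l edge_V[OF e] by auto
    consider "i = 0" | "i = 1" | "i > 1" "C u = i - 2" | "i > 1" "C u \<noteq> i - 2" by linarith
    then show ?thesis
    proof cases
      case 1
      then have "real (pre v) \<in> I u i \<inter> I v i" using le post top edge_V[OF e] by (simp add: I_def)
      then show ?thesis by blast
    next
      case 2
      then have "real (max (lay u) (lay v)) \<in> I u i \<inter> I v i" using l by (auto simp: I_def)
      then show ?thesis by blast
    next
      case 3
      then have "real (pre u) \<in> I u i \<inter> I v i"
        using \<open>C u \<noteq> C v\<close> start_edge[OF e 3(2)] by (simp add: I_def)
      then show ?thesis by blast
    next
      case 4
      \<comment> \<open>\<open>pre v\<close> works whether or not \<open>v\<close> has this colour:
        the half-line of \<open>u\<close> starts no later than \<open>pre u\<close>, hence no later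
        than \<open>pre v\<close>.\<close>
      then have "real (pre v) \<in> I u i \<inter> I v i"
        using start_le[of u "i - 2"] start_le[of v "i - 2"] le by (simp add: I_def)
      then show ?thesis by blast
    qed
  qed
  have apart: "\<exists>i<3 * k + 2. I u i \<inter> I v i = {}"
    if V: "u \<in> ?V" "v \<in> ?V" "u \<noteq> v" and nadj: "(u, v) \<notin> ?E" and le: "pre u \<le> pre v" for u v
  proof -
    consider "post u < pre v" | "lay u + 1 < lay v \<or> lay v + 1 < lay u"
      | "pre v \<le> post u" "lay u \<le> lay v + 1" "lay v \<le> lay u + 1" by linarith
    then show ?thesis
    proof cases
      case 1
      then have "I u 0 \<inter> I v 0 = {}" by (auto simp: I_def)
      then show ?thesis by (intro exI[of _ 0]) simp
    next
      case 2
      then have "I u 1 \<inter> I v 1 = {}" by (auto simp: I_def)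
      then show ?thesis by (intro exI[of _ 1]) simp
    next
      case 3
      have "pre u < start v (C u)" using start_sep[OF V nadj le 3] .
      \<comment> \<open>If \<open>v\<close> has the same colour, the two boxes are distinct points
        here, since \<open>start v (C u)\<close> is at most \<open>pre v\<close>.\<close>
      then have "I u (C u + 2) \<inter> I v (C u + 2) = {}"
        using start_le[of v "C u"] by (auto simp: I_def)
      then show ?thesis using C_less[OF V(1)] by (intro exI[of _ "C u + 2"]) simp
    qed
  qed
  have "(\<Pi>\<^sub>E i\<in>{..<3 * k + 2}. I u i) \<inter> (\<Pi>\<^sub>E i\<in>{..<3 * k + 2}. I v i) \<noteq> {} \<longleftrightarrow> (u, v) \<in> ?E"
    if V: "u \<in> ?V" "v \<in> ?V" "u \<noteq> v" for u v
  proof (cases "pre u \<le> pre v")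
    case True
    then show ?thesis using meet[of u v] apart[OF V]
      by (auto simp: PiE_Int PiE_eq_empty_iff)
  next
    case False
    moreover have "(u, v) \<in> ?E \<longleftrightarrow> (v, u) \<in> ?E" using sym by blast
    ultimately show ?thesis using meet[of v u] apart[of v u] V
      by (auto simp: PiE_Int PiE_eq_empty_iff Int_commute)
  qed
  then have "box_representation G (3 * k + 2) (\<lambda>v. \<Pi>\<^sub>E i\<in>{..<3 * k + 2}. I v i)"
    unfolding box_representation_def using box by blast
  then show ?thesis by blast
qed

theorem theorem5p2:
  fixes G :: "'a pair_pre_digraph"
  assumes "pair_graph G"
  shows "boxicity G \<le> 6 * layered_treewidth G + 4"
proof (cases "\<exists>k. layered_width_at_most G k")
  case True
  then obtain k0 where "enat k0 \<in> enat ` {k. layered_width_at_most G k}" by auto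
  \<comment> \<open>The infimum of a nonempty set is attained because \<open>enat\<close> is
    well-ordered.\<close>
  then have "layered_treewidth G \<in> enat ` {k. layered_width_at_most G k}"
    unfolding layered_treewidth_def by (rule wellorder_InfI)
  then obtain k where k: "layered_width_at_most G k" "layered_treewidth G = enat k" by auto
  have "boxicity G \<le> enat (3 * k + 2)"
    unfolding boxicity_def
    using layered_width_imp_box_representation[OF assms k(1)] by (intro INF_lower) simp
  also have "\<dots> \<le> enat (6 * k + 4)" by simp
  also have "\<dots> = 6 * layered_treewidth G + 4"
    by (simp add: k(2) numeral_eq_enat)
  finally show ?thesis .
next
  case False
  \<comment> \<open>This occurs for the empty graph, which admits no nonempty bag; the bound is then
    infinite.\<close>
  then have "layered_treewidth G = \<infinity>" by (simp add: layered_treewidth_def top_enat_def)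
  then show ?thesis by (simp add: numeral_eq_enat)
qed

end
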